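(* No non-zero point of $\ell_1$ is left-symmetric.
   Context: $\ell_1$ is the space of absolutely summable sequences in $\mathbb{K}$ ($\mathbb{K}=\mathbb{R}$ or $\mathbb{C}$) with norm $\|a\|_1=\sum_n|a_n|$. In a normed space $\mathbb{X}$ over $\mathbb{K}$, $x\perp_B y$ means $\|x+\lambda y\|\ge\|x\|$ for all $\lambda\in\mathbb{K}$. A point $x\in\mathbb{X}$ is left-symmetric if for every $y\in\mathbb{X}$, $x\perp_B y$ implies $y\perp_B x$. *)

theory Defs imports Complex_Main begin

text \<open>
  The library class \<open>real_normed_vector\<close> only provides real scalars; the locale adds a
  scalar multiplication by the elements of a normed field, compatible with the norm.
\<close>

locale normed_space = vector_space scale
  for scale :: "'k::real_normed_field \<Rightarrow> 'v::real_normed_vector \<Rightarrow> 'v" +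
  assumes norm_scale: "norm (scale c x) = norm c * norm x"
begin

definition birkhoff_orthogonal :: "'v \<Rightarrow> 'v \<Rightarrow> bool" where
  "birkhoff_orthogonal x y \<longleftrightarrow> (\<forall>c::'k. norm (x + scale c y) \<ge> norm x)"

definition left_symmetric :: "'v \<Rightarrow> bool" where
  "left_symmetric x \<longleftrightarrow> (\<forall>y. birkhoff_orthogonal x y \<longrightarrow> birkhoff_orthogonal y x)"

end

typedef (overloaded) 'k ell1 =
  "{a :: nat \<Rightarrow> 'k::real_normed_field. summable (\<lambda>n. norm (a n))}"
  morphisms seq_of Abs_ell1
  by (rule exI[of _ "\<lambda>_. 0"]) simp

setup_lifting type_definition_ell1

instantiation ell1 :: (real_normed_field) real_normed_vector
begin

lift_definition zero_ell1 :: "'a ell1" is "\<lambda>_. 0" by simp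

lift_definition plus_ell1 :: "'a ell1 \<Rightarrow> 'a ell1 \<Rightarrow> 'a ell1" is "\<lambda>a b n. a n + b n"
proof -
  fix a b :: "nat \<Rightarrow> 'a"
  assume "summable (\<lambda>n. norm (a n))" and "summable (\<lambda>n. norm (b n))"
  then show "summable (\<lambda>n. norm (a n + b n))"
    by (rule summable_comparison_test'[OF summable_add]) (simp add: norm_triangle_ineq)
qed

lift_definition uminus_ell1 :: "'a ell1 \<Rightarrow> 'a ell1" is "\<lambda>a n. - a n" by simp

lift_definition minus_ell1 :: "'a ell1 \<Rightarrow> 'a ell1 \<Rightarrow> 'a ell1" is "\<lambda>a b n. a n - b n"
proof -
  fix a b :: "nat \<Rightarrow> 'a"
  assume "summable (\<lambda>n. norm (a n))" and "summable (\<lambda>n. norm (b n))"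
  then show "summable (\<lambda>n. norm (a n - b n))"
    by (rule summable_comparison_test'[OF summable_add]) (simp add: norm_triangle_ineq4)
qed

lift_definition scaleR_ell1 :: "real \<Rightarrow> 'a ell1 \<Rightarrow> 'a ell1" is "\<lambda>r a n. r *\<^sub>R a n"
  by (simp add: summable_mult)

lift_definition norm_ell1 :: "'a ell1 \<Rightarrow> real" is "\<lambda>a. \<Sum>n. norm (a n)" .

definition sgn_ell1 :: "'a ell1 \<Rightarrow> 'a ell1" where
  "sgn_ell1 x = inverse (norm x) *\<^sub>R x"

definition dist_ell1 :: "'a ell1 \<Rightarrow> 'a ell1 \<Rightarrow> real" where
  "dist_ell1 x y = norm (x - y)"

definition uniformity_ell1 :: "('a ell1 \<times> 'a ell1) filter" where
  "uniformity_ell1 = (INF e\<in>{0<..}. principal {(x, y). dist x y < e})"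

definition open_ell1 :: "'a ell1 set \<Rightarrow> bool" where
  "open_ell1 U \<longleftrightarrow> (\<forall>x\<in>U. eventually (\<lambda>(x', y). x' = x \<longrightarrow> y \<in> U) uniformity)"

instance
proof
  fix x y z :: "'a ell1" and r s :: real and U :: "'a ell1 set"
  show "x + y + z = x + (y + z)" by transfer (simp add: add.assoc)
  show "x + y = y + x" by transfer (simp add: add.commute)
  show "0 + x = x" by transfer simp
  show "- x + x = 0" by transfer simp
  show "x - y = x + - y" by transfer simp
  show "r *\<^sub>R (x + y) = r *\<^sub>R x + r *\<^sub>R y" by transfer (simp add: scaleR_add_right)
  show "(r + s) *\<^sub>R x = r *\<^sub>R x + s *\<^sub>R x" by transfer (simp add: scaleR_add_left)
  show "r *\<^sub>R s *\<^sub>R x = (r * s) *\<^sub>R x" by transfer simp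
  show "1 *\<^sub>R x = x" by transfer simp
  show "sgn x = inverse (norm x) *\<^sub>R x" by (rule sgn_ell1_def)
  show "dist x y = norm (x - y)" by (rule dist_ell1_def)
  show "(uniformity :: ('a ell1 \<times> 'a ell1) filter) =
      (INF e\<in>{0<..}. principal {(x, y). dist x y < e})" by (rule uniformity_ell1_def)
  show "open U \<longleftrightarrow> (\<forall>x\<in>U. \<forall>\<^sub>F (x', y) in uniformity. x' = x \<longrightarrow> y \<in> U)" by (rule open_ell1_def)
  show "norm x = 0 \<longleftrightarrow> x = 0"
    by transfer (simp add: suminf_eq_zero_iff fun_eq_iff)
  show "norm (x + y) \<le> norm x + norm y"
  proof transfer
    fix a b :: "nat \<Rightarrow> 'a"
    assume a: "summable (\<lambda>n. norm (a n))" and b: "summable (\<lambda>n. norm (b n))"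
    have "summable (\<lambda>n. norm (a n + b n))"
      by (rule summable_comparison_test'[OF summable_add[OF a b]]) (auto intro: norm_triangle_ineq)
    then have "(\<Sum>n. norm (a n + b n)) \<le> (\<Sum>n. norm (a n) + norm (b n))"
      by (intro suminf_le summable_add a b norm_triangle_ineq)
    then show "(\<Sum>n. norm (a n + b n)) \<le> (\<Sum>n. norm (a n)) + (\<Sum>n. norm (b n))"
      by (simp add: suminf_add[OF a b])
  qed
  show "norm (r *\<^sub>R x) = \<bar>r\<bar> * norm x" by transfer (simp add: suminf_mult)
qed

end

lift_definition scale_ell1 :: "'k::real_normed_field \<Rightarrow> 'k ell1 \<Rightarrow> 'k ell1"
  is "\<lambda>c a n. c * a n"
  by (simp add: norm_mult summable_mult)

global_interpretation ell1: normed_space scale_ell1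
proof
  fix x y :: "'a ell1" and c d :: 'a
  show "scale_ell1 c (x + y) = scale_ell1 c x + scale_ell1 c y"
    by transfer (simp add: distrib_left)
  show "scale_ell1 (c + d) x = scale_ell1 c x + scale_ell1 d x"
    by transfer (simp add: distrib_right)
  show "scale_ell1 c (scale_ell1 d x) = scale_ell1 (c * d) x"
    by transfer (simp add: mult.assoc)
  show "scale_ell1 1 x = x" by transfer simp
  show "norm (scale_ell1 c x) = norm c * norm x"
    by transfer (simp add: norm_mult suminf_mult)
qed

end

theory Submission imports Defs begin

text \<open>
  The argument works over every real normed field. Let \<open>x \<noteq> 0\<close> in \<open>\<ell>\<^sub>1\<close> and write \<open>N\<close> for its norm.
  Since the coordinates of \<open>x\<close> tend to zero, some coordinate \<open>x\<^sub>k\<close> has modulus less than \<open>N / 2\<close>. Let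
  \<open>u\<close> be a scalar of modulus one in the direction of \<open>x\<^sub>k\<close>, and move \<open>x\<close> in this coordinate only, to
  \<open>y = x - N u e\<^sub>k\<close>.

  Over \<open>\<real>\<close> or \<open>\<complex>\<close>, the distance \<open>N\<close> is chosen so that \<open>y\<close> lies in the kernel of a norm-one functional
  that attains its norm at \<open>x\<close>, namely the one given by the signs of the coordinates of \<open>x\<close> (with
  value \<open>1 / u\<close> at \<open>k\<close>); hence \<open>x \<perp>\<^sub>B y\<close>. The proof below replaces this functional by one
  triangle inequality. On the other hand \<open>y\<close> is longer than \<open>y - x\<close>: the first has norm
  \<open>2 (N - |x\<^sub>k|) > N\<close> and the second has norm \<open>N\<close>. So \<open>y \<perp>\<^sub>B x\<close> fails at the scalar \<open>-1\<close>, and \<open>x\<close> is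
  not left-symmetric.
\<close>

lift_definition single_ell1 :: "nat \<Rightarrow> 'k::real_normed_field \<Rightarrow> 'k ell1"
  is "\<lambda>k c n. if n = k then c else 0"
  by (simp add: if_distrib[of norm] summable_If_finite cong: if_cong)

lemma scale_single_ell1: "scale_ell1 c (single_ell1 k d) = single_ell1 k (c * d)"
  by transfer (simp add: fun_eq_iff)

text \<open>The vectors in the proof differ from multiples of \<open>x\<close> in one coordinate only, so this formula gives
  all their norms.\<close>

lemma norm_add_single_ell1:
  "norm (x + single_ell1 k c) = norm x - norm (seq_of x k) + norm (seq_of x k + c)"
proof transfer
  fix a :: "nat \<Rightarrow> 'a" and k :: nat and c :: 'a
  assume a: "summable (\<lambda>n. norm (a n))"
  have "(\<lambda>n. norm (a n) + (if n = k then norm (a k + c) - norm (a k) else 0))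
      sums ((\<Sum>n. norm (a n)) + (norm (a k + c) - norm (a k)))"
    by (intro sums_add summable_sums a sums_single)
  moreover have "(\<lambda>n. norm (a n) + (if n = k then norm (a k + c) - norm (a k) else 0)) =
      (\<lambda>n. norm (a n + (if n = k then c else 0)))"
    by (auto simp: fun_eq_iff)
  ultimately show "(\<Sum>n. norm (a n + (if n = k then c else 0))) =
      (\<Sum>n. norm (a n)) - norm (a k) + norm (a k + c)"
    by (simp add: sums_iff)
qed

lemma seq_of_ell1_tendsto_zero: "(\<lambda>n. norm (seq_of x n)) \<longlonglongrightarrow> 0"
  by transfer (rule summable_LIMSEQ_zero)

lemma exists_unit_direction:
  fixes z :: "'k::real_normed_field"
  obtains u where "norm u = 1" and "z = of_real (norm z) * u"
proof (cases "z = 0")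
  case True
  then show ?thesis using that[of 1] by simp
next
  case False
  show ?thesis
  proof (rule that)
    show "norm (sgn z) = 1"
      using False by (simp add: norm_sgn)
    show "z = of_real (norm z) * sgn z"
      using False by (simp add: sgn_div_norm flip: scaleR_conv_of_real)
  qed
qed

text \<open>Moving the coordinate \<open>x\<^sub>k\<close> against its own direction by the full length \<open>\<parallel>x\<parallel>\<close> cancels, in the norming
  functional of signs, exactly what \<open>x\<close> contributes. Concretely, adding the multiple \<open>c\<close> of the shifted
  vector to \<open>x\<close> gives a vector whose norm is a sum of two moduli, off \<open>k\<close> and at \<open>k\<close>; the scalars inside
  them add up to \<open>\<parallel>x\<parallel>\<close>, whatever \<open>c\<close> is.\<close>

lemma birkhoff_orthogonal_shift:
  fixes x :: "'k::real_normed_field ell1"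
  assumes u: "norm u = 1" and xk: "seq_of x k = of_real (norm (seq_of x k)) * u"
  shows "ell1.birkhoff_orthogonal x (x + single_ell1 k (- of_real (norm x) * u))"
  unfolding ell1.birkhoff_orthogonal_def
proof
  fix c :: 'k
  define N where "N = norm x"
  define r where "r = norm (seq_of x k)"
  have "r \<le> N"
    using norm_add_single_ell1[of x k "- seq_of x k"] norm_ge_zero[of "x + single_ell1 k (- seq_of x k)"]
    by (simp add: N_def r_def)
  have seq: "seq_of (scale_ell1 (1 + c) x) k = (1 + c) * of_real r * u"
    by (simp add: scale_ell1.rep_eq xk[folded r_def] mult.assoc)
  have "x + scale_ell1 c (x + single_ell1 k (- of_real N * u)) =
      scale_ell1 (1 + c) x + single_ell1 k (c * (- of_real N * u))"
    by (simp add: ell1.scale_right_distrib ell1.scale_left_distrib scale_single_ell1 add.assoc)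
  then have "norm (x + scale_ell1 c (x + single_ell1 k (- of_real N * u))) =
      norm (scale_ell1 (1 + c) x) - norm ((1 + c) * of_real r * u) +
      norm ((1 + c) * of_real r * u + c * (- of_real N * u))"
    by (simp only: norm_add_single_ell1 seq)
  also have "norm (scale_ell1 (1 + c) x) = norm (1 + c) * N"
    by (simp add: ell1.norm_scale N_def)
  also have "norm ((1 + c) * of_real r * u) = norm (1 + c) * r"
    by (simp add: norm_mult u r_def)
  also have "(1 + c) * of_real r * u + c * (- of_real N * u) =
      ((1 + c) * of_real r - c * of_real N) * u"
    by (simp add: algebra_simps)
  also have "norm \<dots> = norm ((1 + c) * of_real r - c * of_real N)"
    by (simp add: norm_mult u)
  also have "norm (1 + c) * N - norm (1 + c) * r = norm ((1 + c) * of_real (N - r))"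
    using \<open>r \<le> N\<close> by (simp add: norm_mult right_diff_distrib del: of_real_diff)
  finally have eq: "norm (x + scale_ell1 c (x + single_ell1 k (- of_real N * u))) =
      norm ((1 + c) * of_real (N - r)) + norm ((1 + c) * of_real r - c * of_real N)" .
  have "(1 + c) * of_real (N - r) + ((1 + c) * of_real r - c * of_real N) = (of_real N :: 'k)"
    by (simp add: algebra_simps)
  then have "norm (of_real N :: 'k) \<le>
      norm ((1 + c) * of_real (N - r)) + norm ((1 + c) * of_real r - c * of_real N)"
    by (metis norm_triangle_ineq)
  then show "norm x \<le> norm (x + scale_ell1 c (x + single_ell1 k (- of_real (norm x) * u)))"
    using eq by (simp add: N_def)
qed

text \<open>The shift gives a witness \<open>y\<close> with \<open>\<parallel>y - x\<parallel> < \<parallel>y\<parallel>\<close> as soon as the shifted coordinate is smaller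
  than half the norm; infinitely many coordinates guarantee that one is.\<close>

lemma not_left_symmetric_ell1:
  fixes x :: "'k::real_normed_field ell1"
  assumes "x \<noteq> 0"
  shows "\<not> ell1.left_symmetric x"
proof
  assume "ell1.left_symmetric x"
  have "norm x / 2 > 0" using assms by simp
  then have "\<forall>\<^sub>F n in sequentially. norm (seq_of x n) < norm x / 2"
    by (rule order_tendstoD(2)[OF seq_of_ell1_tendsto_zero])
  then obtain k where k: "norm (seq_of x k) < norm x / 2"
    by (auto simp: eventually_sequentially)
  obtain u where u: "norm u = 1" and xk: "seq_of x k = of_real (norm (seq_of x k)) * u"
    using exists_unit_direction .
  define y where "y = x + single_ell1 k (- of_real (norm x) * u)"
  have "ell1.birkhoff_orthogonal y x"
    using \<open>ell1.left_symmetric x\<close> birkhoff_orthogonal_shift[OF u xk]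
    unfolding ell1.left_symmetric_def y_def by blast
  then have "norm y \<le> norm (y + scale_ell1 (- 1) x)"
    unfolding ell1.birkhoff_orthogonal_def by blast
  also have "y + scale_ell1 (- 1) x = 0 + single_ell1 k (- of_real (norm x) * u)"
    by (simp add: y_def)
  also have "norm \<dots> = norm x"
    by (subst norm_add_single_ell1) (simp add: zero_ell1.rep_eq norm_mult u)
  finally have "norm y \<le> norm x" .
  moreover have "norm y = 2 * (norm x - norm (seq_of x k))"
  proof -
    have "seq_of x k + - of_real (norm x) * u = of_real (norm (seq_of x k) - norm x) * u"
      by (subst xk) (simp add: algebra_simps)
    then have "norm (seq_of x k + - of_real (norm x) * u) = \<bar>norm (seq_of x k) - norm x\<bar>"
      by (simp only: norm_mult norm_of_real u mult_1_right)
    moreover have "norm (seq_of x k) \<le> norm x"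
      using k norm_ge_zero[of x] by linarith
    ultimately show ?thesis by (simp add: y_def norm_add_single_ell1)
  qed
  ultimately show False using k by simp
qed

theorem theorem3p6:
  "(\<nexists>x :: real ell1. x \<noteq> 0 \<and> ell1.left_symmetric x) \<and>
   (\<nexists>x :: complex ell1. x \<noteq> 0 \<and> ell1.left_symmetric x)"
  by (intro conjI notI; elim exE conjE; erule (1) notE[OF not_left_symmetric_ell1])

end
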